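(* Let $n,d,k\ge 1$. The set of configurations of $k$ points in $\mathbb{RP}^{n-1}$ that are $d$-independent is open (in the space $(\mathbb{RP}^{n-1})^k$ of $k$-tuples of points).
   Context: $P_{n,d}$ denotes the real vector space of forms in $n$ variables of degree $d$ with real coefficients. For a finite set $S$ of points of $\mathbb{RP}^{n-1}$ (represented by nonzero vectors of $\mathbb{R}^n$), $I_{1,d}(S)=\{p\in P_{n,d} : p(s)=0\ \forall s\in S\}$. A form vanishes to order 2 at $s$ if all its first partial derivatives vanish at $s$. A finite set $S$ is called $d$-independent if: (1) $S$ forces no additional zeroes for forms of degree $d$ that vanish on $S$, i.e. the set of common zeroes in $\mathbb{RP}^{n-1}$ of the forms in $I_{1,d}(S)$ is exactly $S$; and (2) for every $s\in S$, the forms in $P_{n,d}$ that vanish to order 2 at $s$ and vanish on the rest of $S$ form a vector subspace of codimension $|S|+n-1$ in $P_{n,d}$. A configuration of $k$ points is a $k$-tuple of distinct points of $\mathbb{RP}^{n-1}$, and it is $d$-independent if the set of its points is. *)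

theory Defs
  imports "HOL-Analysis.Analysis" "HOL-Analysis.Finite_Function_Topology"
begin

section \<open>Real projective space\<close>

definition proportional :: "real^'n \<Rightarrow> real^'n \<Rightarrow> bool" where
  "proportional x y \<longleftrightarrow> x \<noteq> 0 \<and> y \<noteq> 0 \<and> (\<exists>c. y = c *\<^sub>R x)"

lemma part_equivp_proportional: "part_equivp proportional"
proof (rule part_equivpI)
  show "\<exists>x. proportional x (x :: real^'n)"
    unfolding proportional_def by (rule exI[of _ 1]) (auto intro: exI[of _ "1::real"])
  show "symp (proportional :: real^'n \<Rightarrow> _)"
  proof (rule sympI)
    fix x y :: "real^'n" assume "proportional x y"
    then obtain c where c: "x \<noteq> 0" "y \<noteq> 0" "y = c *\<^sub>R x"
      unfolding proportional_def by blast
    then have "x = inverse c *\<^sub>R y" by auto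
    with c show "proportional y x" unfolding proportional_def by blast
  qed
  show "transp (proportional :: real^'n \<Rightarrow> _)"
    unfolding proportional_def by (rule transpI) (metis scaleR_scaleR)
qed

text \<open>\<open>'n rproj\<close> is the projective space of lines in \<open>real^'n\<close>, of dimension \<open>CARD('n) - 1\<close>.
  The relation is partial since \<open>0\<close> represents no point; \<open>proj_pt\<close> is only meaningful on nonzero
  vectors.\<close>

quotient_type 'n rproj = "real^'n" / partial: "proportional :: real^'n \<Rightarrow> real^'n \<Rightarrow> bool"
  morphisms proj_rep proj_pt
  by (rule part_equivp_proportional)

lemma proj_pt_eq_iff:
  assumes "x \<noteq> 0" "y \<noteq> 0"
  shows "proj_pt x = proj_pt y \<longleftrightarrow> (\<exists>c. y = c *\<^sub>R x)"
proof -
  have "proportional x x" "proportional y y"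
    using assms by (auto simp: proportional_def intro: exI[of _ 1])
  with Quotient3_rel[OF Quotient3_rproj, of x y] show ?thesis
    using assms by (auto simp: proportional_def)
qed

lemma proj_pt_surj: "\<exists>x. x \<noteq> 0 \<and> proj_pt x = s"
  by (metis Quotient3_abs_rep[OF Quotient3_rproj] Quotient3_rep_reflp[OF Quotient3_rproj]
      proportional_def)

text \<open>The quotient topology; the preimage is taken in the open subset of nonzero vectors.\<close>

instantiation rproj :: (finite) topological_space
begin

definition open_rproj :: "'a rproj set \<Rightarrow> bool" where
  "open_rproj U \<longleftrightarrow> open {x. x \<noteq> 0 \<and> proj_pt x \<in> U}"

instance
proof
  have "{x :: real^'a. x \<noteq> 0 \<and> proj_pt x \<in> UNIV} = - {0}" by auto
  then show "open (UNIV :: 'a rproj set)" by (simp add: open_rproj_def open_Compl)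
next
  fix U V :: "'a rproj set"
  assume "open U" "open V"
  moreover have "{x. x \<noteq> 0 \<and> proj_pt x \<in> U \<inter> V} =
    {x. x \<noteq> 0 \<and> proj_pt x \<in> U} \<inter> {x. x \<noteq> 0 \<and> proj_pt x \<in> V}" by auto
  ultimately show "open (U \<inter> V)" by (simp only: open_rproj_def open_Int)
next
  fix K :: "'a rproj set set"
  assume "\<forall>U\<in>K. open U"
  moreover have "{x. x \<noteq> 0 \<and> proj_pt x \<in> \<Union>K} = (\<Union>U\<in>K. {x. x \<noteq> 0 \<and> proj_pt x \<in> U})" by auto
  ultimately show "open (\<Union>K)" by (simp only: open_rproj_def open_UN)
qed

end

lemma quotient_map_proj_pt:
  "quotient_map (top_of_set (- {0 :: real^'n})) euclidean proj_pt"
proof -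
  have "s \<in> proj_pt ` (- {0 :: real^'n})" for s
    using proj_pt_surj[of s] by (metis ComplI image_eqI singletonD)
  then have "proj_pt ` (- {0 :: real^'n}) = UNIV" by blast
  moreover have "openin (top_of_set (- {0})) {x \<in> - {0}. proj_pt x \<in> U} \<longleftrightarrow> open U"
    for U :: "'n rproj set"
    by (subst openin_open_eq) (auto simp: open_rproj_def)
  ultimately show ?thesis by (simp add: quotient_map_def)
qed

section \<open>Forms\<close>

text \<open>A polynomial in variables indexed by \<open>'n\<close> is a finitely supported assignment of
  coefficients to exponent vectors.\<close>

type_synonym 'n rpoly = "('n \<Rightarrow>\<^sub>0 nat) \<Rightarrow>\<^sub>0 real"

definition poly_eval :: "'n::finite rpoly \<Rightarrow> real^'n \<Rightarrow> real" where
  "poly_eval p x = (\<Sum>m\<in>Poly_Mapping.keys p.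
     Poly_Mapping.lookup p m * (\<Prod>i\<in>UNIV. (x $ i) ^ Poly_Mapping.lookup m i))"

definition forms :: "nat \<Rightarrow> 'n::finite rpoly set" where
  "forms d = {p. \<forall>m\<in>Poly_Mapping.keys p. (\<Sum>i\<in>UNIV. Poly_Mapping.lookup m i) = d}"

text \<open>Vanishing is required for all representatives; for forms one representative suffices.\<close>

definition vanishes_at :: "'n::finite rpoly \<Rightarrow> 'n rproj \<Rightarrow> bool" where
  "vanishes_at p s \<longleftrightarrow> (\<forall>x. x \<noteq> 0 \<and> proj_pt x = s \<longrightarrow> poly_eval p x = 0)"

definition vanishes_order2_at :: "'n::finite rpoly \<Rightarrow> 'n rproj \<Rightarrow> bool" where
  "vanishes_order2_at p s \<longleftrightarrow> (\<forall>x. x \<noteq> 0 \<and> proj_pt x = s \<longrightarrow>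
     (\<forall>i. ((\<lambda>h. poly_eval p (x + h *\<^sub>R axis i 1)) has_real_derivative 0) (at 0)))"

definition I1 :: "nat \<Rightarrow> 'n::finite rproj set \<Rightarrow> 'n rpoly set" where
  "I1 d S = {p \<in> forms d. \<forall>s\<in>S. vanishes_at p s}"

definition I2_at :: "nat \<Rightarrow> 'n::finite rproj set \<Rightarrow> 'n rproj \<Rightarrow> 'n rpoly set" where
  "I2_at d S s = {p \<in> forms d. vanishes_order2_at p s \<and> (\<forall>t\<in>S - {s}. vanishes_at p t)}"

text \<open>\<open>codim_in V W\<close> is the codimension of a subspace \<open>W\<close> in a finite-dimensional space \<open>V\<close>
  (\<open>dim\<close> is \<open>0\<close> for infinite-dimensional spaces). The lemmas below show that this applies
  to \<open>I2_at d S s\<close> in \<open>forms d\<close>.\<close>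

definition codim_in :: "'a::real_vector set \<Rightarrow> 'a set \<Rightarrow> nat" where
  "codim_in V W = dim V - dim W"

lemma lookup_scaleR_poly_mapping [simp]:
  "Poly_Mapping.lookup (c *\<^sub>R p) m = c *\<^sub>R Poly_Mapping.lookup p m"
proof -
  have "finite {m. c *\<^sub>R Poly_Mapping.lookup p m \<noteq> 0}"
    by (rule finite_subset[OF _ finite_lookup[of p]]) auto
  then show ?thesis by (simp add: scaleR_poly_mapping_def)
qed

lemma poly_eval_superset:
  assumes "finite M" "Poly_Mapping.keys p \<subseteq> M"
  shows "poly_eval p x = (\<Sum>m\<in>M.
     Poly_Mapping.lookup p m * (\<Prod>i\<in>UNIV. (x $ i) ^ Poly_Mapping.lookup m i))"
  unfolding poly_eval_def using assms
  by (intro sum.mono_neutral_left) (auto simp: in_keys_iff)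

lemma poly_eval_zero: "poly_eval 0 x = 0"
  by (simp add: poly_eval_def)

lemma poly_eval_add: "poly_eval (p + q) x = poly_eval p x + poly_eval q x"
proof -
  let ?M = "Poly_Mapping.keys p \<union> Poly_Mapping.keys q"
  have "Poly_Mapping.keys (p + q) \<subseteq> ?M" by (rule Poly_Mapping.keys_add)
  then show ?thesis
    by (simp add: poly_eval_superset[of ?M] lookup_add distrib_right sum.distrib)
qed

lemma poly_eval_scaleR: "poly_eval (c *\<^sub>R p) x = c * poly_eval p x"
proof -
  have "Poly_Mapping.keys (c *\<^sub>R p) \<subseteq> Poly_Mapping.keys p" by (auto simp: in_keys_iff)
  then show ?thesis
    by (simp add: poly_eval_superset[of "Poly_Mapping.keys p"] sum_distrib_left mult.assoc)
qed

lemma subspace_forms: "subspace (forms d)"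
  unfolding forms_def subspace_def
  using Poly_Mapping.keys_add by (auto simp: in_keys_iff lookup_add)

lemma subspace_I1: "subspace (I1 d S)"
  using subspace_forms[of d]
  by (auto simp: I1_def subspace_def vanishes_at_def poly_eval_zero poly_eval_add poly_eval_scaleR)

lemma subspace_I2_at: "subspace (I2_at d S s)"
  using subspace_forms[of d] unfolding I2_at_def subspace_def vanishes_order2_at_def vanishes_at_def
  by (auto simp: poly_eval_zero poly_eval_add poly_eval_scaleR
      intro: DERIV_add[where D = 0 and E = 0, simplified] DERIV_cmult[where D = 0, simplified])

lemma forms_finite_basis:
  obtains B :: "'n::finite rpoly set" where "finite B" "forms d = span B"
proof
  define M where "M = {m :: 'n \<Rightarrow>\<^sub>0 nat. (\<Sum>i\<in>UNIV. Poly_Mapping.lookup m i) = d}"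
  have "Poly_Mapping.lookup ` M \<subseteq> UNIV \<rightarrow>\<^sub>E {..d}"
    by (auto simp: M_def intro: member_le_sum[where f = "Poly_Mapping.lookup _"])
  then have fin: "finite M"
    using finite_imageD[of Poly_Mapping.lookup M] finite_PiE[of "UNIV :: 'n set" "\<lambda>_. {..d}"]
      finite_subset by (metis finite finite_atMost inj_on_def lookup_inject)
  let ?B = "(\<lambda>m. Poly_Mapping.single m (1::real)) ` M"
  show "finite ?B" using fin by simp
  show "forms d = span ?B"
  proof
    show "span ?B \<subseteq> forms d"
      by (rule span_minimal[OF _ subspace_forms]) (auto simp: forms_def M_def)
    show "forms d \<subseteq> span ?B"
    proof
      fix p :: "'n rpoly" assume "p \<in> forms d"
      then have keys: "Poly_Mapping.keys p \<subseteq> M" by (auto simp: forms_def M_def)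
      have "p = (\<Sum>m\<in>M. Poly_Mapping.lookup p m *\<^sub>R Poly_Mapping.single m 1)"
      proof (rule poly_mapping_eqI)
        fix k
        have "Poly_Mapping.lookup (\<Sum>m\<in>M. Poly_Mapping.lookup p m *\<^sub>R Poly_Mapping.single m 1) k
          = (\<Sum>m\<in>M. if m = k then Poly_Mapping.lookup p k else 0)"
          by (auto simp: lookup_sum lookup_single when_def intro!: sum.cong)
        also have "\<dots> = Poly_Mapping.lookup p k"
          using keys fin by (auto simp: in_keys_iff)
        finally show "Poly_Mapping.lookup p k = Poly_Mapping.lookup
          (\<Sum>m\<in>M. Poly_Mapping.lookup p m *\<^sub>R Poly_Mapping.single m 1) k" ..
      qed
      also have "\<dots> \<in> span ?B" by (intro span_sum span_scale span_base) auto
      finally show "p \<in> span ?B" .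
    qed
  qed
qed

section \<open>Independent configurations\<close>

definition d_independent :: "nat \<Rightarrow> 'n::finite rproj set \<Rightarrow> bool" where
  "d_independent d S \<longleftrightarrow> finite S
     \<and> {t. \<forall>p\<in>I1 d S. vanishes_at p t} = S
     \<and> (\<forall>s\<in>S. codim_in (forms d) (I2_at d S s) = card S + CARD('n) - 1)"

text \<open>\<open>'n rproj ^ 'k\<close> carries the product topology and consists of \<open>CARD('k)\<close>-tuples of points;
  configurations are those with distinct entries.\<close>

definition d_independent_configs :: "nat \<Rightarrow> ('n::finite rproj ^ 'k) set" where
  "d_independent_configs d = {c. inj (($) c) \<and> d_independent d (range (($) c))}"

end

theory Submission
  imports Defs
begin

text \<open>Independence of a configuration is studied on nonzero representatives \<open>x\<^sub>1, \<dots>, x\<^sub>k\<close> of its points,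
  where it can be tested along sequences; since the projection from nonzero vectors to points is an
  open map, openness for representatives is enough.

  The codimension condition at a point \<open>x\<^sub>j\<close> says that the values at the other points and the
  partial derivatives at \<open>x\<^sub>j\<close> are linearly independent functionals on the forms of degree \<open>d\<close>
  (\<open>codim_iff_jets_independent\<close>). These functionals depend continuously on the points, and a limit
  of normalised linear relations is again a nonzero relation (\<open>limit_of_relations\<close>), so the
  condition is open.

  The condition on additional zeros is handled by contradiction. Suppose that configurations
  converging to an independent one have additional zeros \<open>y\<close>, that is, the evaluation at \<open>y\<close> is a
  combination of the evaluations at the points. By compactness the \<open>y\<close> accumulate at some \<open>u\<close>,
  where the same dependence holds in the limit, so \<open>u\<close> is one of the limit points. The
  additional zeros therefore collide with a point \<open>x\<^sub>j\<close>. Subtracting the evaluation at \<open>x\<^sub>j\<close> and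
  dividing by the distance turns the evaluation at \<open>y\<close> into a difference quotient, which tends to
  a derivative at the limit point in a direction transversal to its line. The dependence passes
  to the limit and contradicts the independence of values and derivatives there
  (\<open>no_forced_zeros_converging_to_point\<close>).\<close>

section \<open>Linear relations\<close>

lemma orthogonal_to_proper_image:
  fixes f :: "'a::real_vector \<Rightarrow> 'e::euclidean_space"
  assumes "linear f" "subspace V" "f ` V \<noteq> UNIV"
  obtains z where "z \<noteq> 0" "\<And>p. p \<in> V \<Longrightarrow> z \<bullet> f p = 0"
proof -
  have sub: "subspace (f ` V)"
    using assms by (simp add: linear_subspace_image)
  with assms(3) have "span (f ` V) \<subset> span UNIV"
    by (simp add: span_eq_iff[THEN iffD2, OF sub] psubset_eq)
  then obtain z where "z \<noteq> 0" "\<And>y. y \<in> span (f ` V) \<Longrightarrow> orthogonal z y"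
    using orthogonal_to_subspace_exists_gen by metis
  then show thesis
    by (intro that[of z]) (auto simp: orthogonal_def span_base)
qed

text \<open>Rank-nullity inside an arbitrary real vector space, of which only the subspace \<open>V\<close> has
  finite dimension: a basis \<open>C\<close> of the kernel is extended to a basis \<open>D\<close> of \<open>V\<close>, and \<open>f\<close> carries
  \<open>D - C\<close> to a basis of the image.\<close>

lemma codim_kernel:
  fixes f :: "'a::real_vector \<Rightarrow> 'e::euclidean_space"
  assumes f: "linear f" and fin: "finite B" and V: "V = span B"
  shows "codim_in V {p \<in> V. f p = 0} = dim (f ` V)"
proof -
  let ?W = "{p \<in> V. f p = 0}"
  have subV: "subspace V" using V by simp
  have subW: "subspace ?W"
    using subspace_inter[OF subV linear_subspace_kernel[OF f]]
    by (simp add: Int_def)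
  obtain C where C: "C \<subseteq> ?W" "independent C" "?W \<subseteq> span C"
    using basis_exists[of ?W] by metis
  have spanC: "span C = ?W"
    using C subW by (meson span_minimal subset_antisym)
  obtain D where D: "C \<subseteq> D" "D \<subseteq> V" "independent D" "V \<subseteq> span D"
    using maximal_independent_subset_extend[of C V] C by blast
  have spanD: "span D = V"
    using D subV by (meson span_minimal subset_antisym)
  have finD: "finite D"
    using independent_span_bound[OF fin D(3)] D(2) V by blast
  have dimV: "dim V = card D" by (rule dim_eq_card) (use spanD D subV in \<open>metis span_eq_iff\<close>, rule D(3))
  have dimW: "dim ?W = card C" by (rule dim_eq_card) (use spanC C subW in \<open>metis span_eq_iff\<close>, rule C(2))
  let ?R = "D - C"
  have indR: "independent ?R" using D(3) by (rule independent_mono) auto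
  have inj: "inj_on f (span ?R)"
  proof -
    have "p = 0" if p: "p \<in> span ?R" "f p = 0" for p
    proof -
      have "p \<in> span D" using p(1) span_mono[of ?R D] by blast
      then have "p \<in> span C" using p(2) spanC spanD by auto
      \<comment> \<open>the coordinates of \<open>p\<close> in the basis \<open>D\<close> are supported both in \<open>D - C\<close> and in \<open>C\<close>\<close>
      then have "representation ?R p = representation C p"
        using real_vector.representation_extend[OF D(3)] p(1) D(1) by (metis Diff_subset)
      then have "{b. representation ?R p b \<noteq> 0} = {}"
        using real_vector.representation_ne_zero by (metis (mono_tags, lifting) Collect_empty_eq DiffD2)
      then show ?thesis
        using real_vector.sum_nonzero_representation_eq[OF indR p(1)] by simp
    qed
    then show ?thesis
      using linear_injective_on_subspace_0[OF f, of "span ?R"] by simp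
  qed
  have "f ` V = span (f ` ?R)"
  proof -
    have "f ` V = span (f ` D)" using spanD f by (simp add: linear_span_image)
    also have "\<dots> = span (f ` ?R)" 
    proof -
      have "f ` D \<subseteq> insert 0 (f ` ?R)" using C(1) by auto
      then show ?thesis
        by (metis Diff_subset image_mono span_insert_0 span_mono subset_antisym)
    qed
    finally show ?thesis .
  qed
  then have "dim (f ` V) = card (f ` ?R)"
    using linear_independent_injective_image[OF f indR inj]
    by (simp add: dim_eq_card_independent)
  also have "\<dots> = card ?R"
    by (rule card_image) (rule inj_on_subset[OF inj span_superset])
  also have "\<dots> = card D - card C"
    using D(1) finD by (simp add: card_Diff_subset finite_subset)
  finally show ?thesis by (simp add: codim_in_def dimV dimW)
qed

text \<open>When the image lies in the hyperplane orthogonal to \<open>e\<close>, the kernel has the largest possible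
  codimension exactly when the image fills that hyperplane. This turns a codimension count into
  the absence of linear relations \<open>z\<close> between the coordinates of \<open>f\<close>, which is a condition that
  can be followed through limits.\<close>

lemma codim_kernel_hyperplane_iff:
  fixes f :: "'a::real_vector \<Rightarrow> 'e::euclidean_space"
  assumes f: "linear f" and fin: "finite B" and V: "V = span B"
    and e: "e \<noteq> 0" "\<And>p. p \<in> V \<Longrightarrow> e \<bullet> f p = 0"
  shows "codim_in V {p \<in> V. f p = 0} = DIM('e) - 1 \<longleftrightarrow>
    (\<forall>z. e \<bullet> z = 0 \<and> (\<forall>p\<in>V. z \<bullet> f p = 0) \<longrightarrow> z = 0)"
proof -
  let ?F = "f ` V" and ?H = "{z. e \<bullet> z = 0}"
  have F: "subspace ?F" using f V by (simp add: linear_subspace_image)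
  have H: "subspace ?H" by (rule subspace_hyperplane)
  have FH: "?F \<subseteq> ?H" using e(2) by auto
  have "dim ?F = dim ?H \<longleftrightarrow> ?F = ?H"
    using subspace_dim_equal[OF F H FH] by (intro iffI) simp_all
  also have "\<dots> \<longleftrightarrow> (\<forall>z. z \<in> ?H \<and> (\<forall>y\<in>?F. z \<bullet> y = 0) \<longrightarrow> z = 0)"
  proof
    assume "?F = ?H"
    show "\<forall>z. z \<in> ?H \<and> (\<forall>y\<in>?F. z \<bullet> y = 0) \<longrightarrow> z = 0"
    proof (intro allI impI)
      fix z assume "z \<in> ?H \<and> (\<forall>y\<in>?F. z \<bullet> y = 0)"
      then have "z \<bullet> z = 0" unfolding \<open>?F = ?H\<close> by blast
      then show "z = 0" by simp
    qed
  next
    assume *: "\<forall>z. z \<in> ?H \<and> (\<forall>y\<in>?F. z \<bullet> y = 0) \<longrightarrow> z = 0"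
    show "?F = ?H"
    proof (rule ccontr)
      assume "?F \<noteq> ?H"
      then have "span ?F \<subset> span ?H"
        using FH F H by (metis psubsetI span_eq_iff)
      then obtain z where "z \<noteq> 0" "z \<in> span ?H" "\<And>y. y \<in> span ?F \<Longrightarrow> orthogonal z y"
        using orthogonal_to_subspace_exists_gen by metis
      then show False using * H span_base[of _ ?F]
        by (metis orthogonal_def span_eq_iff)
    qed
  qed
  finally show ?thesis
    by (simp add: codim_kernel[OF f fin V] dim_hyperplane[OF e(1)])
qed

text \<open>Dependence is a closed condition: relations can be scaled to unit length, so a subsequence of
  them converges to a relation that is still nonzero. The functionals
  converge at each \<open>p\<close>, so the pairing with \<open>p\<close> passes to the limit.\<close>

lemma limit_of_relations:
  fixes z :: "nat \<Rightarrow> 'e::euclidean_space" and T :: "nat \<Rightarrow> 'a \<Rightarrow> 'e"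
  assumes C: "subspace C" "\<And>m. z m \<in> C"
    and nz: "\<And>m. z m \<noteq> 0"
    and rel: "\<And>m p. p \<in> V \<Longrightarrow> z m \<bullet> T m p = 0"
    and lim: "\<And>p. p \<in> V \<Longrightarrow> (\<lambda>m. T m p) \<longlonglongrightarrow> L p"
  obtains w where "w \<in> C" "w \<noteq> 0" "\<And>p. p \<in> V \<Longrightarrow> w \<bullet> L p = 0"
proof -
  let ?u = "\<lambda>m. z m /\<^sub>R norm (z m)"
  have "\<forall>m. ?u m \<in> sphere 0 1" using nz by simp
  then obtain w and r :: "nat \<Rightarrow> nat"
    where w: "w \<in> sphere 0 1" "strict_mono r" "(?u \<circ> r) \<longlonglongrightarrow> w"
    using compact_imp_seq_compact[OF compact_sphere, THEN seq_compactE, of ?u 0 1] by blast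
  show thesis
  proof
    show "w \<noteq> 0" using w(1) by auto
    show "w \<in> C"
    proof (rule closed_sequentially[OF closed_subspace[OF C(1)] _ w(3)])
      show "(?u \<circ> r) m \<in> C" for m
        using C by (simp add: subspace_scale)
    qed
    fix p assume p: "p \<in> V"
    have "(\<lambda>m. (?u \<circ> r) m \<bullet> T (r m) p) \<longlonglongrightarrow> w \<bullet> L p"
      using LIMSEQ_subseq_LIMSEQ[OF lim[OF p] w(2)] w(3)
      by (intro tendsto_inner) (auto simp: o_def)
    moreover have "(\<lambda>m. (?u \<circ> r) m \<bullet> T (r m) p) = (\<lambda>m. 0)"
      using rel[OF p] by simp
    ultimately show "w \<bullet> L p = 0"
      by (simp only: LIMSEQ_const_iff)
  qed
qed

section \<open>Gradients of forms\<close>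

definition grad :: "'n::finite rpoly \<Rightarrow> real^'n \<Rightarrow> real^'n" where
  "grad p x = (\<chi> i. \<Sum>m\<in>Poly_Mapping.keys p. Poly_Mapping.lookup p m *
     (real (Poly_Mapping.lookup m i) * (x $ i) ^ (Poly_Mapping.lookup m i - 1) *
      (\<Prod>l\<in>UNIV - {i}. (x $ l) ^ Poly_Mapping.lookup m l)))"

lemma has_derivative_poly_eval:
  "(poly_eval p has_derivative (\<lambda>h. grad p x \<bullet> h)) (at x)"
proof -
  have "((\<lambda>x. \<Sum>m\<in>Poly_Mapping.keys p.
      Poly_Mapping.lookup p m * (\<Prod>i\<in>UNIV. (x $ i) ^ Poly_Mapping.lookup m i)) has_derivative
    (\<lambda>h. \<Sum>m\<in>Poly_Mapping.keys p. Poly_Mapping.lookup p m *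
      (\<Sum>i\<in>UNIV. (real (Poly_Mapping.lookup m i) * (h $ i) * (x $ i) ^ (Poly_Mapping.lookup m i - 1)) *
        (\<Prod>l\<in>UNIV - {i}. (x $ l) ^ Poly_Mapping.lookup m l)))) (at x)"
    by (intro has_derivative_sum has_derivative_mult_right has_derivative_prod has_derivative_power
        bounded_linear_imp_has_derivative[OF bounded_linear_vec_nth])
  moreover have "(\<Sum>m\<in>Poly_Mapping.keys p. Poly_Mapping.lookup p m *
      (\<Sum>i\<in>UNIV. (real (Poly_Mapping.lookup m i) * (h $ i) * (x $ i) ^ (Poly_Mapping.lookup m i - 1)) *
        (\<Prod>l\<in>UNIV - {i}. (x $ l) ^ Poly_Mapping.lookup m l))) = grad p x \<bullet> h" for h
    unfolding grad_def inner_vec_def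
    by (simp add: sum_distrib_left sum_distrib_right mult_ac)
       (subst sum.swap, simp)
  ultimately show ?thesis by (simp add: poly_eval_def[abs_def])
qed

lemma grad_unique:
  assumes "(poly_eval p has_derivative (\<lambda>h. g \<bullet> h)) (at x)"
  shows "grad p x = g"
  using has_derivative_unique[OF has_derivative_poly_eval assms]
  by (metis vector_eq_rdot)

lemma linear_poly_eval: "linear (\<lambda>p. poly_eval p x)"
  by (rule linearI) (simp_all add: poly_eval_add poly_eval_scaleR)

lemma linear_grad: "linear (\<lambda>p. grad p x)"
proof (rule linearI)
  fix p q :: "'a rpoly" and c :: real
  show "grad (p + q) x = grad p x + grad q x"
    using has_derivative_add[OF has_derivative_poly_eval[of p x] has_derivative_poly_eval[of q x]]
    by (intro grad_unique) (simp add: poly_eval_add[abs_def] inner_add_left)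
  show "grad (c *\<^sub>R p) x = c *\<^sub>R grad p x"
    using has_derivative_mult_right[OF has_derivative_poly_eval[of p x], of c]
    by (intro grad_unique) (simp add: poly_eval_scaleR[abs_def])
qed

lemma continuous_poly_eval: "continuous_on A (poly_eval p)"
  unfolding poly_eval_def[abs_def] by (intro continuous_intros)

lemma continuous_grad: "continuous_on A (grad p)"
  unfolding grad_def[abs_def] by (intro continuous_intros)

lemma tendsto_poly_eval: "(f \<longlongrightarrow> x) F \<Longrightarrow> ((\<lambda>m. poly_eval p (f m)) \<longlongrightarrow> poly_eval p x) F"
  using continuous_on_tendsto_compose[OF continuous_poly_eval[of UNIV p]] by auto

lemma tendsto_grad: "(f \<longlongrightarrow> x) F \<Longrightarrow> ((\<lambda>m. grad p (f m)) \<longlongrightarrow> grad p x) F"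
  using continuous_on_tendsto_compose[OF continuous_grad[of UNIV p]] by auto

lemma poly_eval_homogeneous:
  assumes "p \<in> forms d"
  shows "poly_eval p (c *\<^sub>R x) = c ^ d * poly_eval p x"
proof -
  have "(\<Prod>i\<in>UNIV. (c * x $ i) ^ Poly_Mapping.lookup m i) =
    c ^ d * (\<Prod>i\<in>UNIV. (x $ i) ^ Poly_Mapping.lookup m i)" if "m \<in> Poly_Mapping.keys p" for m
    using assms that by (auto simp: forms_def power_mult_distrib prod.distrib power_sum)
  then show ?thesis
    by (simp add: poly_eval_def sum_distrib_left mult_ac cong: sum.cong)
qed

text \<open>The differential of \<open>y \<mapsto> p (c y)\<close> is computed by the chain rule and by homogeneity; comparing
  the two shows that a vanishing gradient does not depend on the representative of a point.\<close>

lemma grad_zero_scaleR: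
  assumes p: "p \<in> forms d" and c: "c \<noteq> 0" and g: "grad p x = 0"
  shows "grad p (c *\<^sub>R x) = 0"
proof -
  have "((\<lambda>y. poly_eval p (c *\<^sub>R y)) has_derivative (\<lambda>h. grad p (c *\<^sub>R x) \<bullet> (c *\<^sub>R h))) (at x)"
    by (rule has_derivative_compose[OF _ has_derivative_poly_eval]) (auto intro!: derivative_eq_intros)
  moreover have "((\<lambda>y. poly_eval p (c *\<^sub>R y)) has_derivative (\<lambda>h. c ^ d * (grad p x \<bullet> h))) (at x)"
    unfolding poly_eval_homogeneous[OF p]
    by (rule has_derivative_mult_right[OF has_derivative_poly_eval])
  ultimately have "(\<lambda>h. grad p (c *\<^sub>R x) \<bullet> (c *\<^sub>R h)) = (\<lambda>h. c ^ d * (grad p x \<bullet> h))"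
    by (rule has_derivative_unique)
  then have "grad p (c *\<^sub>R x) \<bullet> (c *\<^sub>R grad p (c *\<^sub>R x)) = 0"
    using g by (metis inner_zero_left mult_zero_right)
  then show ?thesis using c by simp
qed

text \<open>Euler's identity, from the derivative of \<open>t \<mapsto> p ((1 + t) x)\<close> at \<open>0\<close>.\<close>

lemma grad_inner_self:
  assumes p: "p \<in> forms d"
  shows "grad p x \<bullet> x = real d * poly_eval p x"
proof -
  have "((\<lambda>t. poly_eval p ((1 + t) *\<^sub>R x)) has_derivative (\<lambda>t. grad p ((1 + 0) *\<^sub>R x) \<bullet> (t *\<^sub>R x))) (at 0)"
    by (rule has_derivative_compose[OF _ has_derivative_poly_eval]) (auto intro!: derivative_eq_intros)
  moreover have "((\<lambda>t. poly_eval p ((1 + t) *\<^sub>R x)) has_derivative (\<lambda>t. real d * t * poly_eval p x)) (at 0)"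
    unfolding poly_eval_homogeneous[OF p] by (auto intro!: derivative_eq_intros)
  ultimately have "(\<lambda>t. grad p ((1 + 0) *\<^sub>R x) \<bullet> (t *\<^sub>R x)) = (\<lambda>t. real d * t * poly_eval p x)"
    by (rule has_derivative_unique)
  from fun_cong[OF this, of 1] show ?thesis by simp
qed

text \<open>Both ends of the secant move, so plain differentiability at \<open>a\<close> is not enough; the mean value
  theorem and continuity of the gradient give the limit.\<close>

lemma tendsto_difference_quotient:
  fixes x w :: "nat \<Rightarrow> real^'n::finite"
  assumes x: "x \<longlonglongrightarrow> a" and w: "w \<longlonglongrightarrow> 0" "\<And>m. w m \<noteq> 0"
    and v: "(\<lambda>m. w m /\<^sub>R norm (w m)) \<longlonglongrightarrow> v"
  shows "(\<lambda>m. (poly_eval p (x m + w m) - poly_eval p (x m)) / norm (w m)) \<longlonglongrightarrow> grad p a \<bullet> v"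
proof -
  have "\<exists>t. 0 < t \<and> t < 1 \<and>
      poly_eval p (x m + w m) - poly_eval p (x m) = grad p (x m + t *\<^sub>R w m) \<bullet> w m" for m
  proof -
    have der: "((\<lambda>t. poly_eval p (x m + t *\<^sub>R w m)) has_derivative
        (\<lambda>h. grad p (x m + t *\<^sub>R w m) \<bullet> (h *\<^sub>R w m))) (at t)" for t
      by (rule has_derivative_compose[OF _ has_derivative_poly_eval]) (auto intro!: derivative_eq_intros)
    have "((\<lambda>t. poly_eval p (x m + t *\<^sub>R w m)) has_real_derivative
        grad p (x m + t *\<^sub>R w m) \<bullet> w m) (at t)" for t
      using der[of t] by (simp add: has_field_derivative_def mult_commute_abs)
    from MVT2[of 0 1, OF _ this] show ?thesis by auto
  qed
  then obtain t where t: "\<And>m. 0 < t m \<and> t m < 1" "\<And>m. poly_eval p (x m + w m) - poly_eval p (x m) =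
      grad p (x m + t m *\<^sub>R w m) \<bullet> w m" by metis
  have "(\<lambda>m. t m *\<^sub>R w m) \<longlonglongrightarrow> 0"
  proof (rule Lim_null_comparison)
    show "\<forall>\<^sub>F m in sequentially. norm (t m *\<^sub>R w m) \<le> norm (w m)"
      using t(1) by (intro always_eventually) (auto intro!: mult_left_le_one_le simp: less_imp_le abs_of_pos)
    show "(\<lambda>m. norm (w m)) \<longlonglongrightarrow> 0" using w(1) tendsto_norm_zero by blast
  qed
  with x have "(\<lambda>m. x m + t m *\<^sub>R w m) \<longlonglongrightarrow> a" using tendsto_add by fastforce
  from tendsto_inner[OF tendsto_grad[OF this, of p] v] show ?thesis
    by (simp add: t(2) divide_inverse mult.commute)
qed

section \<open>Jets along a configuration\<close>

lemma all_proj_pt: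
  fixes P :: "'n::finite rproj \<Rightarrow> bool"
  shows "(\<forall>t. P t) \<longleftrightarrow> (\<forall>y. y \<noteq> 0 \<longrightarrow> P (proj_pt y))"
proof safe
  fix t :: "'n rproj"
  assume "\<forall>y. y \<noteq> 0 \<longrightarrow> P (proj_pt y)"
  moreover obtain y where "y \<noteq> 0" "proj_pt y = t" using proj_pt_surj by blast
  ultimately show "P t" by blast
qed simp

lemma vanishes_at_proj_pt:
  assumes p: "p \<in> forms d" and x: "x \<noteq> 0"
  shows "vanishes_at p (proj_pt x) \<longleftrightarrow> poly_eval p x = 0"
proof
  show "vanishes_at p (proj_pt x) \<Longrightarrow> poly_eval p x = 0"
    using x by (simp add: vanishes_at_def)
  assume *: "poly_eval p x = 0"
  show "vanishes_at p (proj_pt x)"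
    unfolding vanishes_at_def
  proof (intro allI impI)
    fix y assume "y \<noteq> 0 \<and> proj_pt y = proj_pt x"
    then obtain c where "y = c *\<^sub>R x" using proj_pt_eq_iff[OF x] by metis
    then show "poly_eval p y = 0" using * poly_eval_homogeneous[OF p] by simp
  qed
qed

lemma has_real_derivative_along_axis:
  "((\<lambda>h. poly_eval p (x + h *\<^sub>R axis i 1)) has_real_derivative grad p x $ i) (at 0)"
proof -
  have "((\<lambda>h. poly_eval p (x + h *\<^sub>R axis i 1)) has_derivative
      (\<lambda>h. grad p (x + 0 *\<^sub>R axis i 1) \<bullet> (h *\<^sub>R axis i 1))) (at 0)"
    by (rule has_derivative_compose[OF _ has_derivative_poly_eval]) (auto intro!: derivative_eq_intros)
  then show ?thesis
    by (simp add: has_field_derivative_def inner_axis mult_commute_abs)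
qed

lemma vanishes_order2_at_proj_pt:
  assumes p: "p \<in> forms d" and x: "x \<noteq> 0"
  shows "vanishes_order2_at p (proj_pt x) \<longleftrightarrow> grad p x = 0"
proof -
  have partial: "((\<lambda>h. poly_eval p (y + h *\<^sub>R axis i 1)) has_real_derivative 0) (at 0) \<longleftrightarrow>
      grad p y $ i = 0" for y i
    using has_real_derivative_along_axis[of p y i] DERIV_unique[OF has_real_derivative_along_axis]
    by metis
  show ?thesis
  proof
    assume "vanishes_order2_at p (proj_pt x)"
    then show "grad p x = 0"
      using x by (simp add: vanishes_order2_at_def partial vec_eq_iff)
  next
    assume g: "grad p x = 0"
    have "grad p y = 0" if y: "y \<noteq> 0" "proj_pt y = proj_pt x" for y
    proof -
      obtain c where c: "y = c *\<^sub>R x" using proj_pt_eq_iff[OF x y(1)] y(2) by metis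
      with y have "c \<noteq> 0" by auto
      then show ?thesis using grad_zero_scaleR[OF p _ g] c by simp
    qed
    then show "vanishes_order2_at p (proj_pt x)"
      by (simp add: vanishes_order2_at_def partial)
  qed
qed

text \<open>The data of a form that enter the second condition of independence at the \<open>j\<close>-th point. The
  slot \<open>j\<close> of the values is emptied because, by Euler's identity, the gradient already determines
  the value there.\<close>

definition jet :: "'k \<Rightarrow> real^'n^'k \<Rightarrow> 'n::finite rpoly \<Rightarrow> (real^'k) \<times> (real^'n)" where
  "jet j x p = ((\<chi> i. if i = j then 0 else poly_eval p (x $ i)), grad p (x $ j))"

lemma jet_eq_0_iff:
  "jet j x p = 0 \<longleftrightarrow> (\<forall>i. i \<noteq> j \<longrightarrow> poly_eval p (x $ i) = 0) \<and> grad p (x $ j) = 0"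
  by (auto simp: jet_def zero_prod_def vec_eq_iff)

text \<open>There is no linear relation \<open>z\<close> between the values at the other points and the partial
  derivatives at the \<open>j\<close>-th point. The coefficient of the empty slot is fixed to \<open>0\<close>, since it would
  otherwise be arbitrary.\<close>

definition jets_independent :: "nat \<Rightarrow> 'k::finite \<Rightarrow> real^'n::finite^'k \<Rightarrow> bool" where
  "jets_independent d j x \<longleftrightarrow>
    (\<forall>z. fst z $ j = 0 \<and> (\<forall>p\<in>forms d. z \<bullet> jet j x p = 0) \<longrightarrow> z = 0)"

definition forced_zero :: "nat \<Rightarrow> real^'n::finite^'k::finite \<Rightarrow> real^'n \<Rightarrow> bool" where
  "forced_zero d x y \<longleftrightarrow>
    (\<forall>p\<in>forms d. (\<forall>i. poly_eval p (x $ i) = 0) \<longrightarrow> poly_eval p y = 0)"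

definition cuts_out :: "nat \<Rightarrow> real^'n::finite^'k::finite \<Rightarrow> bool" where
  "cuts_out d x \<longleftrightarrow> (\<forall>y. y \<noteq> 0 \<longrightarrow> forced_zero d x y \<longrightarrow> (\<exists>i c. y = c *\<^sub>R x $ i))"

lemma linear_jet: "linear (jet j x)"
  by (intro linearI)
    (simp_all add: jet_def vec_eq_iff poly_eval_add poly_eval_scaleR
      linear_add[OF linear_grad] linear_scale[OF linear_grad])

text \<open>A relation between all the values and one directional derivative at the \<open>j\<close>-th point becomes a
  relation between jets when the value at that point is replaced, through Euler's identity, by
  the derivative in the radial direction divided by \<open>d\<close>.\<close>

lemma relation_with_derivative:
  assumes ind: "jets_independent d j x" and d: "d \<ge> 1"
    and rel: "\<And>p. p \<in> forms d \<Longrightarrow> (\<Sum>i\<in>UNIV. a $ i * poly_eval p (x $ i)) + grad p (x $ j) \<bullet> v = 0"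
  shows "\<And>i. i \<noteq> j \<Longrightarrow> a $ i = 0" "(a $ j / real d) *\<^sub>R x $ j + v = 0"
proof -
  let ?z = "((\<chi> i. if i = j then 0 else a $ i), (a $ j / real d) *\<^sub>R x $ j + v)"
  have "?z \<bullet> jet j x p = 0" if p: "p \<in> forms d" for p
  proof -
    have "(\<Sum>i\<in>UNIV. a $ i * poly_eval p (x $ i)) =
        a $ j * poly_eval p (x $ j) + (\<Sum>i\<in>UNIV - {j}. a $ i * poly_eval p (x $ i))"
      by (rule sum.remove) auto
    moreover have "(\<Sum>i\<in>UNIV. (if i = j then 0 else a $ i) * (if i = j then 0 else poly_eval p (x $ i))) =
        (\<Sum>i\<in>UNIV - {j}. a $ i * poly_eval p (x $ i))"
      by (rule sum.mono_neutral_cong_right) auto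
    moreover have "((a $ j / real d) *\<^sub>R x $ j + v) \<bullet> grad p (x $ j) =
        a $ j * poly_eval p (x $ j) + grad p (x $ j) \<bullet> v"
      using grad_inner_self[OF p, of "x $ j"] d
      by (subst inner_commute) (simp add: inner_add_right)
    moreover have "?z \<bullet> jet j x p =
        (\<Sum>i\<in>UNIV. (if i = j then 0 else a $ i) * (if i = j then 0 else poly_eval p (x $ i))) +
        ((a $ j / real d) *\<^sub>R x $ j + v) \<bullet> grad p (x $ j)"
      by (simp only: jet_def inner_Pair inner_vec_def[of "vec_lambda _" "vec_lambda _"]
          vec_lambda_beta inner_real_def)
    ultimately show ?thesis
      using rel[OF p] by linarith
  qed
  moreover have "fst ?z $ j = 0" by simp
  ultimately have "?z = 0"
    using ind unfolding jets_independent_def by blast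
  then show "\<And>i. i \<noteq> j \<Longrightarrow> a $ i = 0" "(a $ j / real d) *\<^sub>R x $ j + v = 0"
    by (auto simp: zero_prod_def vec_eq_iff split: if_splits)
qed

lemma evaluations_independent:
  assumes "jets_independent d j x" "d \<ge> 1" "x $ j \<noteq> 0"
    and "\<And>p. p \<in> forms d \<Longrightarrow> (\<Sum>i\<in>UNIV. a $ i * poly_eval p (x $ i)) = 0"
  shows "a = 0"
proof -
  have "a $ i = 0" for i
    using relation_with_derivative[OF assms(1,2), of a 0] assms(2-4) by (cases "i = j") auto
  then show ?thesis by (simp add: vec_eq_iff)
qed

text \<open>Representatives of one point have proportional evaluations by homogeneity, which is a relation
  with coefficient \<open>1\<close> at the index \<open>i\<close>.\<close>

lemma points_distinct:
  fixes x :: "real^'n::finite^'k::finite"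
  assumes "jets_independent d j x" "d \<ge> 1" "i \<noteq> j"
  shows "x $ i \<noteq> c *\<^sub>R x $ j"
proof
  assume *: "x $ i = c *\<^sub>R x $ j"
  let ?a = "axis i 1 - c ^ d *\<^sub>R axis j 1 :: real^'k"
  have "(\<Sum>l\<in>UNIV. ?a $ l * poly_eval p (x $ l)) + grad p (x $ j) \<bullet> 0 = 0" if "p \<in> forms d" for p
  proof -
    have "(\<Sum>l\<in>UNIV. ?a $ l * poly_eval p (x $ l)) = ?a \<bullet> (\<chi> l. poly_eval p (x $ l))"
      by (simp add: inner_vec_def)
    also have "\<dots> = 0"
      by (simp add: inner_diff_left inner_axis' * poly_eval_homogeneous[OF that])
    finally show ?thesis by simp
  qed
  from relation_with_derivative(1)[OF assms(1,2) this assms(3)] assms(3)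
  show False by (simp add: axis_def)
qed

lemma codim_iff_jets_independent:
  fixes x :: "real^'n::finite^'k::finite"
  assumes nz: "\<And>i. x $ i \<noteq> 0" and inj: "inj (\<lambda>i. proj_pt (x $ i))"
  shows "codim_in (forms d) (I2_at d (range (\<lambda>i. proj_pt (x $ i))) (proj_pt (x $ j))) =
      CARD('k) + CARD('n) - 1 \<longleftrightarrow> jets_independent d j x"
proof -
  let ?S = "range (\<lambda>i. proj_pt (x $ i))"
  have "?S - {proj_pt (x $ j)} = (\<lambda>i. proj_pt (x $ i)) ` (UNIV - {j})"
    using inj by (auto dest: injD)
  then have W: "I2_at d ?S (proj_pt (x $ j)) = {p \<in> forms d. jet j x p = 0}"
    unfolding I2_at_def jet_eq_0_iff
    by (auto simp: vanishes_at_proj_pt[where d = d] nz vanishes_order2_at_proj_pt[where d = d])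
  obtain B :: "'n rpoly set" where B: "finite B" "forms d = span B"
    by (rule forms_finite_basis)
  let ?e = "(axis j 1, 0) :: (real^'k) \<times> (real^'n)"
  have e: "?e \<bullet> z = fst z $ j" for z
    by (cases z) (simp add: inner_axis')
  have "?e \<noteq> 0" by (simp add: zero_prod_def axis_eq_0_iff)
  from codim_kernel_hyperplane_iff[OF linear_jet B this, of j x]
  show ?thesis
    unfolding W e jets_independent_def by (simp add: jet_def)
qed

text \<open>Independence in terms of representatives. The independence of the jets implies that the
  points are distinct, which in turn makes the codimension condition readable off the jets.\<close>

lemma config_iff:
  fixes x :: "real^'n::finite^'k::finite"
  assumes nz: "\<And>i. x $ i \<noteq> 0" and d: "d \<ge> 1"
  shows "(\<chi> i. proj_pt (x $ i)) \<in> d_independent_configs d \<longleftrightarrow>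
    (\<forall>j. jets_independent d j x) \<and> cuts_out d x"
proof -
  let ?c = "\<lambda>i. proj_pt (x $ i)"
  have I1: "I1 d (range ?c) = {p \<in> forms d. \<forall>i. poly_eval p (x $ i) = 0}"
    unfolding I1_def using nz by (auto simp: vanishes_at_proj_pt[where d = d])
  have zeros: "{t. \<forall>p\<in>I1 d (range ?c). vanishes_at p t} = range ?c \<longleftrightarrow> cuts_out d x"
  proof -
    have "range ?c \<subseteq> {t. \<forall>p\<in>I1 d (range ?c). vanishes_at p t}"
      by (auto simp: I1_def)
    moreover have "{t. \<forall>p\<in>I1 d (range ?c). vanishes_at p t} \<subseteq> range ?c \<longleftrightarrow>
        (\<forall>t. (\<forall>p\<in>I1 d (range ?c). vanishes_at p t) \<longrightarrow> t \<in> range ?c)"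
      by blast
    moreover have "\<dots> \<longleftrightarrow> (\<forall>y. y \<noteq> 0 \<longrightarrow>
        (\<forall>p\<in>I1 d (range ?c). vanishes_at p (proj_pt y)) \<longrightarrow> proj_pt y \<in> range ?c)"
      by (rule all_proj_pt)
    moreover have "\<dots> \<longleftrightarrow> cuts_out d x"
    proof -
      have "proj_pt y \<in> range ?c \<longleftrightarrow> (\<exists>i c. y = c *\<^sub>R x $ i)" if "y \<noteq> 0" for y
        using proj_pt_eq_iff[OF nz that] by (simp add: image_iff eq_commute[of "proj_pt y"])
      moreover have "(\<forall>p\<in>I1 d (range ?c). vanishes_at p (proj_pt y)) \<longleftrightarrow> forced_zero d x y" if "y \<noteq> 0" for y
        using vanishes_at_proj_pt[OF _ that] by (auto simp: I1 forced_zero_def)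
      ultimately show ?thesis unfolding cuts_out_def by (simp cong: imp_cong)
    qed
    ultimately show ?thesis by blast
  qed
  have inj: "inj ?c" if "\<forall>j. jets_independent d j x"
  proof (rule injI)
    fix i j assume "?c i = ?c j"
    then obtain c where "x $ i = c *\<^sub>R x $ j"
      using proj_pt_eq_iff nz by metis
    then show "i = j" using points_distinct that d by blast
  qed
  show ?thesis
  proof (cases "inj ?c")
    case True
    then have "card (range ?c) = CARD('k)" by (rule card_image)
    then show ?thesis
      using True codim_iff_jets_independent[OF nz True, of d] zeros
      by (auto simp add: d_independent_configs_def d_independent_def vec_lambda_inverse)
  next
    case False
    then show ?thesis using inj
      by (auto simp add: d_independent_configs_def vec_lambda_inverse)
  qed
qed

section \<open>Limits of dependent configurations\<close>

lemma tendsto_jet: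
  assumes "(x \<longlongrightarrow> l) F"
  shows "((\<lambda>m. jet j (x m) p) \<longlongrightarrow> jet j l p) F"
proof -
  have "((\<lambda>m. if i = j then 0 else poly_eval p (x m $ i)) \<longlongrightarrow>
      (if i = j then 0 else poly_eval p (l $ i))) F" for i
    using tendsto_poly_eval[OF tendsto_vec_nth[OF assms]] by simp
  then show ?thesis
    unfolding jet_def
    by (intro tendsto_Pair tendsto_vec_lambda tendsto_grad tendsto_vec_nth assms)
qed

lemma open_jets_independent: "open {x :: real^'n::finite^'k::finite. jets_independent d j x}"
proof -
  have "closed (- {x :: real^'n^'k. jets_independent d j x})"
    unfolding closed_sequential_limits
  proof (intro allI impI, elim conjE)
    fix x :: "nat \<Rightarrow> real^'n^'k" and l
    assume "\<forall>m. x m \<in> - {x. jets_independent d j x}" and lim: "x \<longlonglongrightarrow> l"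
    then have "\<exists>z. z \<noteq> 0 \<and> fst z $ j = 0 \<and> (\<forall>p\<in>forms d. z \<bullet> jet j (x m) p = 0)" for m
      unfolding jets_independent_def by blast
    then obtain z where z: "\<And>m. z m \<noteq> 0" "\<And>m. fst (z m) $ j = 0"
      "\<And>m p. p \<in> forms d \<Longrightarrow> z m \<bullet> jet j (x m) p = 0" by metis
    have sub: "subspace {z :: (real^'k) \<times> (real^'n). fst z $ j = 0}"
      by (simp add: subspace_def)
    have zC: "z m \<in> {z. fst z $ j = 0}" for m using z(2) by simp
    obtain w where "w \<in> {z. fst z $ j = 0}" "w \<noteq> 0" "\<And>p. p \<in> forms d \<Longrightarrow> w \<bullet> jet j l p = 0"
      by (rule limit_of_relations[where V = "forms d" and T = "\<lambda>m. jet j (x m)" and L = "jet j l",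
            OF sub zC z(1) z(3) tendsto_jet[OF lim]]; (assumption | rule that))
    then show "l \<in> - {x. jets_independent d j x}"
      unfolding jets_independent_def Compl_iff mem_Collect_eq by blast
  qed
  then show ?thesis by (simp add: open_closed)
qed

lemma forced_zero_scaleR: "forced_zero d x y \<Longrightarrow> forced_zero d x (c *\<^sub>R y)"
  by (simp add: forced_zero_def poly_eval_homogeneous)

text \<open>A zero of all forms through the points is the same as a linear dependence of the evaluations at
  the points and at \<open>y\<close>: one direction is duality, the other one (\<open>relation_forced_zero\<close>)
  rests on the independence of the evaluations at the points, which forces \<open>y\<close> to occur in the
  dependence.\<close>

lemma forced_zero_relation:
  fixes x :: "real^'n::finite^'k::finite"
  assumes "forced_zero d x y"
  obtains z :: "(real^'k) \<times> real" where "z \<noteq> 0"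
    "\<And>p. p \<in> forms d \<Longrightarrow> z \<bullet> (\<chi> i. poly_eval p (x $ i), poly_eval p y) = 0"
proof -
  let ?f = "\<lambda>p. (\<chi> i. poly_eval p (x $ i), poly_eval p y) :: (real^'k) \<times> real"
  have "linear ?f"
    by (rule linearI) (simp_all add: vec_eq_iff poly_eval_add poly_eval_scaleR)
  moreover have "(0, 1) \<notin> ?f ` forms d"
    using assms by (auto simp: forced_zero_def vec_eq_iff)
  ultimately show thesis
    using orthogonal_to_proper_image[of ?f "forms d"] subspace_forms that by blast
qed

lemma inner_evaluations:
  fixes z :: "(real^'k::finite) \<times> real"
  shows "z \<bullet> (\<chi> i. f i, c) = (\<Sum>i\<in>UNIV. fst z $ i * f i) + snd z * c"
  by (cases z) (simp add: inner_vec_def)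

lemma relation_forced_zero:
  fixes z :: "(real^'k) \<times> real" and x :: "real^'n::finite^'k::finite"
  assumes "jets_independent d j x" "d \<ge> 1" "x $ j \<noteq> 0" and z: "z \<noteq> 0"
    and rel: "\<And>p. p \<in> forms d \<Longrightarrow> z \<bullet> (\<chi> i. poly_eval p (x $ i), poly_eval p y) = 0"
  shows "forced_zero d x y"
proof -
  have "snd z \<noteq> 0"
  proof
    assume *: "snd z = 0"
    then have "fst z = 0"
      using rel by (intro evaluations_independent[OF assms(1-3)]) (simp add: inner_evaluations)
    with * z show False by (simp add: prod_eq_iff)
  qed
  moreover have "snd z * poly_eval p y = 0" if "p \<in> forms d" "\<forall>i. poly_eval p (x $ i) = 0" for p
    using rel[OF that(1)] that(2) by (simp add: inner_evaluations)
  ultimately show ?thesis by (simp add: forced_zero_def)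
qed

text \<open>The displacements \<open>w\<close> are orthogonal to the representatives, so their directions accumulate at
  a unit vector \<open>v\<close> transversal to the line of the limit point. A forced zero at \<open>x\<^sub>j + w\<close> gives a
  relation between evaluations; rewritten with the difference quotient along \<open>w\<close> in place of the
  evaluation at \<open>x\<^sub>j + w\<close> it survives in the limit as a relation between the evaluations and the
  derivative along \<open>v\<close>. Independence of the jets leaves only a relation between the radial
  direction and \<open>v\<close>, and these are orthogonal.\<close>

lemma no_forced_zeros_converging_to_point:
  fixes x :: "nat \<Rightarrow> real^'n::finite^'k::finite"
  assumes d: "d \<ge> 1" and ind: "jets_independent d j l" and nz: "l $ j \<noteq> 0"
    and x: "x \<longlonglongrightarrow> l" and w: "w \<longlonglongrightarrow> 0" "\<And>m. w m \<noteq> 0" "\<And>m. w m \<bullet> x m $ j = 0"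
    and forced: "\<And>m. forced_zero d (x m) (x m $ j + w m)"
  shows False
proof -
  let ?u = "\<lambda>m. w m /\<^sub>R norm (w m)"
  have "\<forall>m. ?u m \<in> sphere 0 1" using w(2) by simp
  then obtain v and r :: "nat \<Rightarrow> nat"
    where v: "v \<in> sphere 0 1" "strict_mono r" "(?u \<circ> r) \<longlonglongrightarrow> v"
    using compact_imp_seq_compact[OF compact_sphere, THEN seq_compactE, of ?u 0 1] by blast
  define X W where "X = x \<circ> r" and "W = w \<circ> r"
  have X: "X \<longlonglongrightarrow> l" and W: "W \<longlonglongrightarrow> 0" "\<And>m. W m \<noteq> 0" "\<And>m. W m \<bullet> X m $ j = 0"
    using x w v(2) by (simp_all add: X_def W_def LIMSEQ_subseq_LIMSEQ)
  have u: "(\<lambda>m. W m /\<^sub>R norm (W m)) \<longlonglongrightarrow> v" using v(3) by (simp add: W_def o_def)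
  have Xj: "(\<lambda>m. X m $ j) \<longlonglongrightarrow> l $ j" using X by (rule tendsto_vec_nth)
  have "(\<lambda>m. (W m /\<^sub>R norm (W m)) \<bullet> X m $ j) \<longlonglongrightarrow> v \<bullet> l $ j"
    using u Xj by (rule tendsto_inner)
  then have perp: "v \<bullet> l $ j = 0" using W(3) by (simp add: LIMSEQ_const_iff)
  have "\<exists>z :: (real^'k) \<times> real. z \<noteq> 0 \<and> (\<forall>p\<in>forms d.
      z \<bullet> (\<chi> i. poly_eval p (X m $ i), poly_eval p (X m $ j + W m)) = 0)" for m
    using forced_zero_relation[OF forced[of "r m"]] unfolding X_def W_def comp_def by metis
  then obtain z :: "nat \<Rightarrow> (real^'k) \<times> real" where z: "\<And>m. z m \<noteq> 0"
    "\<And>m p. p \<in> forms d \<Longrightarrow> z m \<bullet> (\<chi> i. poly_eval p (X m $ i), poly_eval p (X m $ j + W m)) = 0"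
    by metis
  \<comment> \<open>coefficients after the change of functionals from the evaluation at \<open>x\<^sub>j + w\<close> to the quotient\<close>
  define Z where "Z m = (fst (z m) + snd (z m) *\<^sub>R axis j 1, snd (z m) * norm (W m))" for m
  define T where "T m p = ((\<chi> i. poly_eval p (X m $ i)) :: real^'k,
    (poly_eval p (X m $ j + W m) - poly_eval p (X m $ j)) / norm (W m))" for m p
  have Znz: "Z m \<noteq> 0" for m
  proof
    assume *: "Z m = 0"
    then have "snd (z m) = 0" using W(2) by (simp add: Z_def zero_prod_def)
    with * have "z m = 0" by (simp add: Z_def prod_eq_iff)
    with z(1) show False by blast
  qed
  have rel: "Z m \<bullet> T m p = 0" if p: "p \<in> forms d" for m p
  proof -
    have "(\<Sum>i\<in>UNIV. axis j 1 $ i * poly_eval p (X m $ i)) = axis j 1 \<bullet> (\<chi> i. poly_eval p (X m $ i))"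
      by (simp add: inner_vec_def)
    then have "(\<Sum>i\<in>UNIV. axis j 1 $ i * poly_eval p (X m $ i)) = poly_eval p (X m $ j)"
      by (simp add: inner_axis')
    then have "Z m \<bullet> T m p = z m \<bullet> (\<chi> i. poly_eval p (X m $ i), poly_eval p (X m $ j + W m))"
      using W(2)[of m] unfolding Z_def T_def inner_evaluations
      by (simp add: distrib_right sum.distrib mult.assoc flip: sum_distrib_left)
        (simp add: algebra_simps)
    then show ?thesis using z(2)[OF p] by simp
  qed
  have lim: "(\<lambda>m. T m p) \<longlonglongrightarrow> (\<chi> i. poly_eval p (l $ i), grad p (l $ j) \<bullet> v)"
    if "p \<in> forms d" for p
    unfolding T_def
    by (intro tendsto_Pair tendsto_vec_lambda tendsto_poly_eval tendsto_vec_nth X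
        tendsto_difference_quotient[OF Xj W(1,2) u])
  obtain q :: "(real^'k) \<times> real" where q: "q \<noteq> 0"
    "\<And>p. p \<in> forms d \<Longrightarrow> q \<bullet> (\<chi> i. poly_eval p (l $ i), grad p (l $ j) \<bullet> v) = 0"
    by (rule limit_of_relations[where V = "forms d" and T = T and
          L = "\<lambda>p. (\<chi> i. poly_eval p (l $ i), grad p (l $ j) \<bullet> v)",
          OF subspace_UNIV UNIV_I Znz rel lim]; (assumption | rule that))
  have "(\<Sum>i\<in>UNIV. fst q $ i * poly_eval p (l $ i)) + grad p (l $ j) \<bullet> (snd q *\<^sub>R v) = 0"
    if "p \<in> forms d" for p
    using q(2)[OF that] by (simp add: inner_evaluations)
  note * = relation_with_derivative[OF ind d this]
  have "v \<bullet> ((fst q $ j / real d) *\<^sub>R l $ j + snd q *\<^sub>R v) = 0" using *(2) by simp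
  then have snd: "snd q = 0" using perp v(1) by (auto simp: inner_add_right)
  then have "fst q $ j = 0" using *(2) nz d by simp
  then have "fst q = 0" using *(1) by (metis vec_eq_iff zero_index)
  with snd q(1) show False by (simp add: prod_eq_iff)
qed

text \<open>Forced zeros off the points are taken of norm \<open>1\<close>, so they accumulate at a forced zero \<open>u\<close> of the
  limit configuration. As that configuration is cut out by forms, \<open>u\<close> is a multiple of one of
  its points \<open>l\<^sub>j\<close>, and after rescaling the forced zeros converge to \<open>l\<^sub>j\<close> in the way excluded by
  \<open>no_forced_zeros_converging_to_point\<close>.\<close>

lemma no_extra_forced_zeros_near:
  fixes x :: "nat \<Rightarrow> real^'n::finite^'k::finite"
  assumes d: "d \<ge> 1" and nz: "\<And>i. l $ i \<noteq> 0" and ind: "\<And>j. jets_independent d j l"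
    and cut: "cuts_out d l" and x: "x \<longlonglongrightarrow> l" and xnz: "\<And>m i. x m $ i \<noteq> 0"
  shows "\<exists>m. cuts_out d (x m)"
proof (rule ccontr)
  assume contra: "\<not> ?thesis"
  then have "\<exists>y. y \<in> sphere 0 1 \<and> forced_zero d (x m) y \<and> (\<forall>i c. y \<noteq> c *\<^sub>R x m $ i)" for m
  proof -
    obtain y where y: "y \<noteq> 0" "forced_zero d (x m) y" "\<And>i c. y \<noteq> c *\<^sub>R x m $ i"
      using contra unfolding cuts_out_def by blast
    have "y /\<^sub>R norm y \<noteq> c *\<^sub>R x m $ i" for i c
    proof
      assume "y /\<^sub>R norm y = c *\<^sub>R x m $ i"
      then have "norm y *\<^sub>R (y /\<^sub>R norm y) = (norm y * c) *\<^sub>R x m $ i" by simp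
      with y(1,3) show False by simp
    qed
    with y(1) forced_zero_scaleR[OF y(2)] show ?thesis
      by (intro exI[of _ "y /\<^sub>R norm y"]) simp
  qed
  then obtain y where y: "\<And>m. y m \<in> sphere 0 1" "\<And>m. forced_zero d (x m) (y m)"
    "\<And>m i c. y m \<noteq> c *\<^sub>R x m $ i" by metis
  obtain u and r :: "nat \<Rightarrow> nat"
    where u: "u \<in> sphere 0 1" "strict_mono r" "(y \<circ> r) \<longlonglongrightarrow> u"
    using compact_imp_seq_compact[OF compact_sphere, THEN seq_compactE, of y 0 1] y(1) by blast
  define X Y where "X = x \<circ> r" and "Y = y \<circ> r"
  have X: "X \<longlonglongrightarrow> l" and Y: "Y \<longlonglongrightarrow> u"
    using x u by (simp_all add: X_def Y_def LIMSEQ_subseq_LIMSEQ)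
  have forced: "forced_zero d (X m) (Y m)" and off: "Y m \<noteq> c *\<^sub>R X m $ i" for m i c
    using y(2,3) by (simp_all add: X_def Y_def)
  have "forced_zero d l u"
  proof -
    have "\<exists>z :: (real^'k) \<times> real. z \<noteq> 0 \<and> (\<forall>p\<in>forms d.
        z \<bullet> (\<chi> i. poly_eval p (X m $ i), poly_eval p (Y m)) = 0)" for m
      using forced_zero_relation[OF forced] by metis
    then obtain z :: "nat \<Rightarrow> (real^'k) \<times> real" where z: "\<And>m. z m \<noteq> 0"
      "\<And>m p. p \<in> forms d \<Longrightarrow> z m \<bullet> (\<chi> i. poly_eval p (X m $ i), poly_eval p (Y m)) = 0"
      by metis
    have lim: "(\<lambda>m. (\<chi> i. poly_eval p (X m $ i), poly_eval p (Y m)) :: (real^'k) \<times> real)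
        \<longlonglongrightarrow> (\<chi> i. poly_eval p (l $ i), poly_eval p u)"
      if "p \<in> forms d" for p
      by (intro tendsto_Pair tendsto_vec_lambda tendsto_poly_eval tendsto_vec_nth X Y)
    obtain q :: "(real^'k) \<times> real" where "q \<noteq> 0"
      "\<And>p. p \<in> forms d \<Longrightarrow> q \<bullet> (\<chi> i. poly_eval p (l $ i), poly_eval p u) = 0"
      by (rule limit_of_relations[where V = "forms d" and
            T = "\<lambda>m p. (\<chi> i. poly_eval p (X m $ i), poly_eval p (Y m))" and
            L = "\<lambda>p. (\<chi> i. poly_eval p (l $ i), poly_eval p u)",
            OF subspace_UNIV UNIV_I z lim]; (assumption | rule that))
    then show ?thesis by (rule relation_forced_zero[OF ind d nz])
  qed
  moreover have "u \<noteq> 0" using u(1) by auto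
  ultimately obtain j c where c: "u = c *\<^sub>R l $ j"
    using cut unfolding cuts_out_def by blast
  with \<open>u \<noteq> 0\<close> have "c \<noteq> 0" by auto
  \<comment> \<open>the multiple \<open>s Y\<close> differs from \<open>x\<^sub>j\<close> by a vector orthogonal to \<open>x\<^sub>j\<close>\<close>
  define s where "s m = (X m $ j \<bullet> X m $ j) / (Y m \<bullet> X m $ j)" for m
  define w where "w m = s m *\<^sub>R Y m - X m $ j" for m
  have Xj: "(\<lambda>m. X m $ j) \<longlonglongrightarrow> l $ j" using X by (rule tendsto_vec_nth)
  have Yl: "(\<lambda>m. Y m \<bullet> X m $ j) \<longlonglongrightarrow> u \<bullet> l $ j" using Y Xj by (rule tendsto_inner)
  have ul: "u \<bullet> l $ j \<noteq> 0" using c nz \<open>c \<noteq> 0\<close> by simp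
  have "s \<longlonglongrightarrow> (l $ j \<bullet> l $ j) / (u \<bullet> l $ j)"
    unfolding s_def by (intro tendsto_divide tendsto_inner Xj Yl ul)
  also have "(l $ j \<bullet> l $ j) / (u \<bullet> l $ j) = inverse c"
    using nz[of j] \<open>c \<noteq> 0\<close> by (simp add: c field_simps)
  finally have s: "s \<longlonglongrightarrow> inverse c" .
  have "w \<longlonglongrightarrow> inverse c *\<^sub>R u - l $ j"
    unfolding w_def by (intro tendsto_diff tendsto_scaleR s Y Xj)
  then have w: "w \<longlonglongrightarrow> 0" using c \<open>c \<noteq> 0\<close> by simp
  have "\<forall>\<^sub>F m in sequentially. Y m \<bullet> X m $ j \<noteq> 0"
    using tendsto_imp_eventually_ne[OF Yl ul] .
  then obtain N where N: "\<And>m. m \<ge> N \<Longrightarrow> Y m \<bullet> X m $ j \<noteq> 0"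
    by (auto simp: eventually_sequentially)
  show False
  proof (rule no_forced_zeros_converging_to_point[OF d ind nz])
    show "(\<lambda>m. X (m + N)) \<longlonglongrightarrow> l" using X by (rule LIMSEQ_ignore_initial_segment)
    show "(\<lambda>m. w (m + N)) \<longlonglongrightarrow> 0" using w by (rule LIMSEQ_ignore_initial_segment)
    fix m
    have ne: "Y (m + N) \<bullet> X (m + N) $ j \<noteq> 0" by (rule N) simp
    show "w (m + N) \<bullet> X (m + N) $ j = 0"
      using ne by (simp add: w_def s_def inner_diff_left)
    show "w (m + N) \<noteq> 0"
    proof
      assume "w (m + N) = 0"
      then have *: "s (m + N) *\<^sub>R Y (m + N) = X (m + N) $ j" by (simp add: w_def)
      have "s (m + N) \<noteq> 0" using ne xnz by (simp add: s_def X_def)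
      then have "Y (m + N) = inverse (s (m + N)) *\<^sub>R X (m + N) $ j" by (simp flip: *)
      with off show False by blast
    qed
    show "forced_zero d (X (m + N)) (X (m + N) $ j + w (m + N))"
      using forced_zero_scaleR[OF forced] by (simp add: w_def)
  qed
qed

lemma open_independent_representatives:
  assumes d: "d \<ge> 1"
  shows "open {x :: real^'n::finite^'k::finite.
    (\<forall>i. x $ i \<noteq> 0) \<and> (\<chi> i. proj_pt (x $ i)) \<in> d_independent_configs d}" (is "open ?W")
proof -
  let ?J = "(\<Inter>i. {x :: real^'n^'k. x $ i \<noteq> 0}) \<inter> (\<Inter>j. {x. jets_independent d j x})"
  have "open {x :: real^'n^'k. x $ i \<noteq> 0}" for i
    by (intro open_Collect_neq continuous_intros)
  then have W0: "open ?J"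
    by (intro open_Int open_INT ballI open_jets_independent) simp_all
  have W: "?W = ?J \<inter> {x. cuts_out d x}"
  proof (rule set_eqI)
    fix x :: "real^'n^'k"
    have "x \<in> ?J \<inter> {x. cuts_out d x} \<longleftrightarrow>
        (\<forall>i. x $ i \<noteq> 0) \<and> (\<forall>j. jets_independent d j x) \<and> cuts_out d x" by blast
    also have "\<dots> \<longleftrightarrow> x \<in> ?W"
    proof (cases "\<forall>i. x $ i \<noteq> 0")
      case True
      then have nz: "x $ i \<noteq> 0" for i by blast
      have "x \<in> ?W \<longleftrightarrow> (\<chi> i. proj_pt (x $ i)) \<in> d_independent_configs d"
        using nz by simp
      also have "\<dots> \<longleftrightarrow> (\<forall>j. jets_independent d j x) \<and> cuts_out d x"
        using nz d by (rule config_iff)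
      finally show ?thesis using True by blast
    next
      case False
      then show ?thesis by blast
    qed
    finally show "x \<in> ?W \<longleftrightarrow> x \<in> ?J \<inter> {x. cuts_out d x}" ..
  qed
  have "closed (- ?W)"
    unfolding closed_sequential_limits
  proof (intro allI impI, elim conjE)
    fix x :: "nat \<Rightarrow> real^'n^'k" and l
    assume out: "\<forall>m. x m \<in> - ?W" and lim: "x \<longlonglongrightarrow> l"
    show "l \<in> - ?W"
    proof
      assume l: "l \<in> ?W"
      then have "l \<in> ?J" unfolding W by (rule IntD1)
      then have "\<forall>\<^sub>F m in sequentially. x m \<in> ?J"
        by (rule topological_tendstoD[OF lim W0])
      then obtain N where N: "\<And>m. m \<ge> N \<Longrightarrow> x m \<in> ?J"
        by (auto simp: eventually_sequentially)
      have "\<exists>m. cuts_out d (x (m + N))"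
      proof (rule no_extra_forced_zeros_near[OF d])
        show "(\<lambda>m. x (m + N)) \<longlonglongrightarrow> l" using lim by (rule LIMSEQ_ignore_initial_segment)
        show "cuts_out d l" using l unfolding W by blast
        show "l $ i \<noteq> 0" "jets_independent d i l" for i using \<open>l \<in> ?J\<close> by blast+
        show "x (m + N) $ i \<noteq> 0" for m i using N[of "m + N"] by simp
      qed
      then obtain m where "cuts_out d (x (m + N))" by blast
      then have "x (m + N) \<in> ?W" using N[of "m + N"] unfolding W by simp
      moreover have "x (m + N) \<notin> ?W" by (rule ComplD) (rule out[rule_format])
      ultimately show False by (rule notE[rotated])
    qed
  qed
  then show ?thesis by (simp add: open_closed)
qed

section \<open>Descent to projective space\<close>

text \<open>The lines through an open set sweep out an open cone, the union of its nonzero multiples.\<close>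

lemma open_proj_pt_image:
  fixes A :: "(real^'n::finite) set"
  assumes "open A"
  shows "open (proj_pt ` (A - {0}))"
proof -
  have "{x. x \<noteq> 0 \<and> proj_pt x \<in> proj_pt ` (A - {0})} = (\<Union>c\<in>-{0}. (\<lambda>x. c *\<^sub>R x) ` (A - {0}))"
  proof (intro set_eqI iffI)
    fix x assume x: "x \<in> {x. x \<noteq> 0 \<and> proj_pt x \<in> proj_pt ` (A - {0})}"
    then obtain a where a: "a \<in> A - {0}" "proj_pt a = proj_pt x"
      by (elim CollectE conjE imageE) simp
    with x obtain c where c: "x = c *\<^sub>R a" using proj_pt_eq_iff[of a x] by auto
    with x have "c \<in> - {0}" by auto
    with c a(1) show "x \<in> (\<Union>c\<in>-{0}. (\<lambda>x. c *\<^sub>R x) ` (A - {0}))" by blast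
  next
    fix x assume "x \<in> (\<Union>c\<in>-{0}. (\<lambda>x. c *\<^sub>R x) ` (A - {0}))"
    then obtain c a where *: "c \<noteq> 0" "a \<in> A - {0}" "x = c *\<^sub>R a" by blast
    then have "proj_pt x = proj_pt a" using proj_pt_eq_iff[of a x] by auto
    moreover have "proj_pt a \<in> proj_pt ` (A - {0})" using *(2) by (rule imageI)
    moreover have "x \<noteq> 0" using * by simp
    ultimately show "x \<in> {x. x \<noteq> 0 \<and> proj_pt x \<in> proj_pt ` (A - {0})}"
      by (simp only: mem_Collect_eq simp_thms)
  qed
  moreover have "open (A - {0})" using assms by (simp add: open_delete)
  ultimately show ?thesis
    unfolding open_rproj_def by (auto intro!: open_UN open_scaling)
qed

theorem proposition3p6:
  fixes d :: nat
  assumes "d \<ge> 1"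
  shows "open (d_independent_configs d :: ('n::finite rproj ^ 'k::finite) set)"
  unfolding open_vec_def
proof
  let ?W = "{x :: real^'n^'k. (\<forall>i. x $ i \<noteq> 0) \<and> (\<chi> i. proj_pt (x $ i)) \<in> d_independent_configs d}"
  fix c :: "'n rproj ^ 'k" assume c: "c \<in> d_independent_configs d"
  have "\<forall>i. \<exists>x. x \<noteq> 0 \<and> proj_pt x = c $ i" using proj_pt_surj by blast
  from choice[OF this] obtain f where f: "\<And>i. f i \<noteq> 0" "\<And>i. proj_pt (f i) = c $ i" by blast
  then have "(\<chi> i. f i) \<in> ?W" using c by simp
  with open_independent_representatives[OF assms]
  have "\<exists>A. (\<forall>i. open (A i) \<and> (\<chi> i. f i) $ i \<in> A i) \<and> (\<forall>x. (\<forall>i. x $ i \<in> A i) \<longrightarrow> x \<in> ?W)"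
    unfolding open_vec_def by (rule bspec)
  then obtain A where
    A: "\<And>i. open (A i)" "\<And>i. f i \<in> A i" "\<And>x. (\<And>i. x $ i \<in> A i) \<Longrightarrow> x \<in> ?W"
    unfolding vec_lambda_beta by blast
  show "\<exists>B. (\<forall>i. open (B i) \<and> c $ i \<in> B i) \<and>
      (\<forall>y. (\<forall>i. y $ i \<in> B i) \<longrightarrow> y \<in> d_independent_configs d)"
  proof (intro exI[of _ "\<lambda>i. proj_pt ` (A i - {0})"] conjI allI impI)
    show "open (proj_pt ` (A i - {0}))" for i using A(1) by (rule open_proj_pt_image)
    show "c $ i \<in> proj_pt ` (A i - {0})" for i
      using A(2) f by (metis DiffI image_eqI singletonD)
    fix y :: "'n rproj ^ 'k" assume "\<forall>i. y $ i \<in> proj_pt ` (A i - {0})"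
    then have "\<forall>i. \<exists>g. g \<in> A i \<and> y $ i = proj_pt g" by blast
    then obtain g where g: "\<And>i. g i \<in> A i" "\<And>i. y $ i = proj_pt (g i)" by metis
    have "(\<chi> i. g i) \<in> ?W" by (rule A(3)) (simp add: g)
    then have "(\<chi> i. proj_pt (g i)) \<in> d_independent_configs d" by simp
    also have "(\<chi> i. proj_pt (g i)) = y" by (simp add: vec_eq_iff g)
    finally show "y \<in> d_independent_configs d" .
  qed
qed

end
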